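(* Let $T$ be an infinite, locally finite tree with infinite motion. Then $\chi_D(T)\leq 3$, where $\chi_D(T)$ is the distinguishing chromatic number of $T$.
   Context: Graphs are simple and undirected; a graph is infinite if it has infinitely many vertices, and locally finite if all of its vertex degrees are finite. The motion of an automorphism is the number of vertices moved by it, and the motion of a graph is the minimum of the motions of its non-identity automorphisms; thus a graph has infinite motion if every non-identity automorphism moves infinitely many vertices. The distinguishing chromatic number $\chi_D(G)$ of a graph $G$ is the minimum number of colours in a proper vertex colouring $c$ of $G$ (adjacent vertices receive distinct colours) that is preserved only by the trivial automorphism, where an automorphism $\varphi$ preserves $c$ if $c(\varphi(v))=c(v)$ for all vertices $v$. *)

theory Defs
  imports "Graph_Theory.Graph_Theory" "HOL-Library.Extended_Nat"
begin

text \<open>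
  A simple undirected graph, finite or infinite, is a value of type \<open>'a pair_pre_digraph\<close> that
  satisfies \<open>pair_bidirected_digraph\<close>: a vertex set with a symmetric, irreflexive relation
  \<open>parcs\<close> on it, in which an edge between \<open>u\<close> and \<open>v\<close> is represented by the two arcs
  \<open>(u, v)\<close> and \<open>(v, u)\<close>.
\<close>

text \<open>
  The predicate \<open>tree\<close> of the graph library is meant for directed graphs. It counts an arc followed
  by its reverse as a cycle, so a symmetric graph with an edge is never a \<open>tree\<close>. Cycles of an
  undirected graph are the directed cycles of length at least 3.
\<close>

definition undirected_tree :: "'a pair_pre_digraph \<Rightarrow> bool" where
  "undirected_tree G \<longleftrightarrow> pair_bidirected_digraph G \<and> connected (with_proj G) \<and>
     \<not> (\<exists>p. pre_digraph.cycle (with_proj G) p \<and> 3 \<le> length p)"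

definition locally_finite :: "'a pair_pre_digraph \<Rightarrow> bool" where
  "locally_finite G \<longleftrightarrow> (\<forall>v \<in> pverts G. finite (out_arcs (with_proj G) v))"

text \<open>
  Automorphisms are maps on the whole type, but only their values on vertices matter: the identity
  automorphism is any automorphism fixing every vertex.
\<close>

definition automorphism :: "'a pair_pre_digraph \<Rightarrow> ('a \<Rightarrow> 'a) \<Rightarrow> bool" where
  "automorphism G f \<longleftrightarrow> bij_betw f (pverts G) (pverts G) \<and>
     (\<forall>u \<in> pverts G. \<forall>v \<in> pverts G. (u, v) \<in> parcs G \<longleftrightarrow> (f u, f v) \<in> parcs G)"

definition moved_verts :: "'a pair_pre_digraph \<Rightarrow> ('a \<Rightarrow> 'a) \<Rightarrow> 'a set" where
  "moved_verts G f = {v \<in> pverts G. f v \<noteq> v}"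

text \<open>All infinite cardinalities are identified with \<open>\<infinity>\<close>.\<close>

definition ecard :: "'a set \<Rightarrow> enat" where
  "ecard A = (if finite A then enat (card A) else \<infinity>)"

text \<open>The motion of a graph without non-identity automorphisms is \<open>\<infinity>\<close>.\<close>

definition motion :: "'a pair_pre_digraph \<Rightarrow> enat" where
  "motion G = (INF f \<in> {f. automorphism G f \<and> moved_verts G f \<noteq> {}}. ecard (moved_verts G f))"

lemma motion_eq_infinity_iff:
  "motion G = \<infinity> \<longleftrightarrow>
     (\<forall>f. automorphism G f \<and> (\<exists>v \<in> pverts G. f v \<noteq> v) \<longrightarrow> infinite {v \<in> pverts G. f v \<noteq> v})"
proof -
  have "motion G = \<infinity> \<longleftrightarrow>
      (\<forall>f. automorphism G f \<and> moved_verts G f \<noteq> {} \<longrightarrow> ecard (moved_verts G f) = \<infinity>)"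
    unfolding motion_def top_enat_def [symmetric] INF_top_conv by blast
  then show ?thesis
    by (simp add: ecard_def moved_verts_def) blast
qed

definition proper_colouring :: "'a pair_pre_digraph \<Rightarrow> ('a \<Rightarrow> 'c) \<Rightarrow> bool" where
  "proper_colouring G c \<longleftrightarrow> (\<forall>u v. (u, v) \<in> parcs G \<longrightarrow> c u \<noteq> c v)"

definition preserves_colouring ::
    "'a pair_pre_digraph \<Rightarrow> ('a \<Rightarrow> 'a) \<Rightarrow> ('a \<Rightarrow> 'c) \<Rightarrow> bool" where
  "preserves_colouring G f c \<longleftrightarrow> (\<forall>v \<in> pverts G. c (f v) = c v)"

definition distinguishing_colouring :: "'a pair_pre_digraph \<Rightarrow> ('a \<Rightarrow> 'c) \<Rightarrow> bool" where
  "distinguishing_colouring G c \<longleftrightarrow>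
     (\<forall>f. automorphism G f \<and> preserves_colouring G f c \<longrightarrow> (\<forall>v \<in> pverts G. f v = v))"

text \<open>
  Natural numbers suffice as colours, because every colouring with finitely many colours can be
  renamed to use them; the value is \<open>\<infinity>\<close> exactly if no finite number of colours is enough.
\<close>

definition distinguishing_chromatic_number :: "'a pair_pre_digraph \<Rightarrow> enat" where
  "distinguishing_chromatic_number G =
     (INF c \<in> {c :: 'a \<Rightarrow> nat. proper_colouring G c \<and> distinguishing_colouring G c}.
        ecard (c ` pverts G))"

end

theory Submission
  imports Defs "HOL-Library.Countable_Set" "HOL-Library.Nat_Bijection"
begin

text \<open>
  Fix a root \<open>r\<close> and call a vertex large if it has infinitely many descendants. For each large
  vertex \<open>w\<close> choose a descendant \<open>d w\<close> at an odd level \<open>\<ge> 3\<close> such that distinct large vertices get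
  distinct levels. Give colour 2 to \<open>r\<close> and to all \<open>d w\<close>, and colour the other vertices by the parity
  of their level. The neighbours of \<open>r\<close> have colour 1 and those of the \<open>d w\<close> have colour 0, so an
  automorphism that preserves the colours fixes \<open>r\<close>. It then preserves levels, so it fixes every
  \<open>d w\<close> and hence, being compatible with parents, every large vertex. If it moved another vertex,
  then it would permute the finite branches at some fixed vertex nontrivially. Restricting it to
  these branches gives a nontrivial automorphism of finite motion.
\<close>

section \<open>Rooted trees\<close>

locale rooted_tree = pair_bidirected_digraph T for T :: "'a pair_pre_digraph" +
  fixes r :: 'a
  assumes root: "r \<in> pverts T"
    and conn: "connected (with_proj T)"
    and acyclic: "\<And>p. cycle p \<Longrightarrow> length p < 3"
begin

abbreviation V :: "'a set" where "V \<equiv> pverts T"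
abbreviation E :: "'a rel" where "E \<equiv> parcs T"

section \<open>Levels: distances from the root\<close>

definition level :: "'a \<Rightarrow> nat" where
  "level v = (LEAST n. (r, v) \<in> E ^^ n)"

lemma E_in_V: "(u, v) \<in> E \<Longrightarrow> u \<in> V" "(u, v) \<in> E \<Longrightarrow> v \<in> V"
  using in_arcsD1 in_arcsD2 by auto

lemma E_sym: "(u, v) \<in> E \<longleftrightarrow> (v, u) \<in> E"
  using arcs_symmetric by blast

lemma relpow_level:
  assumes "v \<in> V"
  shows "(r, v) \<in> E ^^ level v"
proof -
  have "symmetric (with_proj T)"
    by (rule pair_sym_arcs)
  then have "strongly_connected (with_proj T)"
    using symmetric_connected_imp_strongly_connected conn by blast
  then have "r \<rightarrow>\<^sup>*\<^bsub>with_proj T\<^esub> v"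
    using root assms by (auto simp: strongly_connected_def)
  then have "(r, v) \<in> E\<^sup>*"
    using reachable_rtranclI by fastforce
  then obtain n where "(r, v) \<in> E ^^ n"
    using rtrancl_imp_relpow by blast
  then show ?thesis
    unfolding level_def by (rule LeastI)
qed

lemma level_le: "(r, v) \<in> E ^^ n \<Longrightarrow> level v \<le> n"
  unfolding level_def by (rule Least_le)

lemma level_le_Suc: "(u, v) \<in> E \<Longrightarrow> level v \<le> Suc (level u)"
  using relpow_level[of u] E_in_V(1) by (intro level_le) auto

lemma level_root: "level r = 0"
  using level_le[of r 0] by simp

lemma level_eq_0_iff: "v \<in> V \<Longrightarrow> level v = 0 \<longleftrightarrow> v = r"
  using relpow_level[of v] level_root by auto

text \<open>Take the last vertex before \<open>v\<close> on a shortest walk from the root; since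
  levels grow by at most one along an edge, it lies exactly one level lower.\<close>

lemma ex_parent:
  assumes "v \<in> V" "v \<noteq> r"
  shows "\<exists>u. (u, v) \<in> E \<and> level v = Suc (level u)"
proof -
  obtain n where n: "level v = Suc n"
    using level_eq_0_iff[of v] assms by (cases "level v") auto
  then have "(r, v) \<in> E ^^ Suc n"
    using relpow_level[OF assms(1)] by simp
  then obtain u where "(r, u) \<in> E ^^ n" "(u, v) \<in> E"
    by auto
  then show ?thesis
    using n level_le level_le_Suc by fastforce
qed

section \<open>Consequences of acyclicity\<close>

lemma awalk_snoc:
  assumes "awalk a p b" "(b, v) \<in> E"
  shows "awalk a (p @ [(b, v)]) v" "pawalk_verts a (p @ [(b, v)]) = pawalk_verts a p @ [v]"
proof -
  have "awalk b [(b, v)] v"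
    using assms(2) E_in_V(2) by (simp add: awalk_simps)
  with assms(1) show "awalk a (p @ [(b, v)]) v"
    by (rule awalk_appendI)
  show "pawalk_verts a (p @ [(b, v)]) = pawalk_verts a p @ [v]"
    using assms(1) by (induction p arbitrary: a) (simp_all add: awalk_simps)
qed

text \<open>If \<open>v\<close> were off the path, the two edges at \<open>v\<close> would close it
  to a cycle. As \<open>a \<noteq> b\<close>, the path has at least one arc, so that cycle has
  length at least 3.\<close>

lemma no_detour:
  assumes "(v, a) \<in> E" "apath a p b" "(b, v) \<in> E" "a \<noteq> b"
  shows "v \<in> set (pawalk_verts a p)"
proof (rule ccontr)
  assume v: "v \<notin> set (pawalk_verts a p)"
  let ?p = "(v, a) # p @ [(b, v)]"
  have p: "awalk a p b" "distinct (pawalk_verts a p)"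
    using assms(2) unfolding apath_def by simp_all
  note snoc = awalk_snoc[OF p(1) assms(3)]
  have "awalk v ?p v"
    using snoc(1) assms(1) unfolding awalk_Cons_iff by simp
  moreover have "distinct (tl (pawalk_verts v ?p))"
    using snoc(2) p(2) v by simp
  ultimately have "cycle ?p"
    unfolding cycle_def by blast
  moreover have "p \<noteq> []"
    using p(1) assms(4) awalk_empty_ends by blast
  ultimately show False
    using acyclic[of ?p] by (cases p) simp_all
qed

text \<open>Join the parents of \<open>a\<close> and \<open>b\<close> by induction and add the two
  end edges. The level bound keeps \<open>a\<close> and \<open>b\<close> off the inner path, and
  later keeps higher vertices off the whole path.\<close>

lemma apath_same_level:
  assumes "a \<in> V" "b \<in> V" "level a = n" "level b = n"
  shows "\<exists>p. apath a p b \<and> (\<forall>x \<in> set (pawalk_verts a p). level x \<le> n)"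
  using assms
proof (induction n arbitrary: a b)
  case 0
  then have "a = r" "b = r"
    using level_eq_0_iff by simp_all
  moreover have "apath r [] r"
    using root by (simp add: apath_Nil_iff)
  ultimately show ?case
    using level_root by (metis empty_iff empty_set le_refl pawalk_verts.simps(1) set_ConsD)
next
  case (Suc n)
  show ?case
  proof (cases "a = b")
    case True
    then have "apath a [] b"
      using Suc.prems by (simp add: apath_Nil_iff)
    then show ?thesis
      using Suc.prems by (metis empty_iff empty_set le_refl pawalk_verts.simps(1) set_ConsD)
  next
    case False
    have nr: "a \<noteq> r" "b \<noteq> r"
      using Suc.prems level_root by auto
    obtain a' where a': "(a', a) \<in> E" "level a' = n"
      using ex_parent[OF Suc.prems(1) nr(1)] Suc.prems(3) by auto
    obtain b' where b': "(b', b) \<in> E" "level b' = n"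
      using ex_parent[OF Suc.prems(2) nr(2)] Suc.prems(4) by auto
    obtain p where p: "apath a' p b'" "\<forall>x \<in> set (pawalk_verts a' p). level x \<le> n"
      using Suc.IH[OF E_in_V(1)[OF a'(1)] E_in_V(1)[OF b'(1)] a'(2) b'(2)] by blast
    let ?p = "(a, a') # p @ [(b', b)]"
    have aw: "awalk a' p b'" "distinct (pawalk_verts a' p)"
      using p(1) unfolding apath_def by simp_all
    note snoc = awalk_snoc[OF aw(1) b'(1)]
    have verts: "pawalk_verts a ?p = a # pawalk_verts a' p @ [b]"
      using snoc(2) by simp
    have "a \<notin> set (pawalk_verts a' p)" "b \<notin> set (pawalk_verts a' p)"
      using p(2) Suc.prems(3,4) by auto
    then have "distinct (pawalk_verts a ?p)"
      unfolding verts using aw(2) False by simp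
    moreover have "awalk a ?p b"
      using snoc(1) a'(1) arcs_symmetric unfolding awalk_Cons_iff by simp
    ultimately have "apath a ?p b"
      by (simp add: apath_def)
    moreover have "\<forall>x \<in> set (pawalk_verts a ?p). level x \<le> Suc n"
      unfolding verts using p(2) Suc.prems(3,4) by auto
    ultimately show ?thesis
      by blast
  qed
qed

text \<open>A path between two different parents that stays at or below their level avoids
  \<open>v\<close>, which contradicts \<open>no_detour\<close>.\<close>

lemma parent_unique:
  assumes "(u, v) \<in> E" "(u', v) \<in> E" "level v = Suc (level u)" "level v = Suc (level u')"
  shows "u = u'"
proof (rule ccontr)
  assume "u \<noteq> u'"
  obtain p where "apath u p u'" "\<forall>x \<in> set (pawalk_verts u p). level x \<le> level u"
    using apath_same_level[of u u' "level u"] assms E_in_V by auto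
  then show False
    using no_detour[of v u p u'] \<open>u \<noteq> u'\<close> assms E_sym by fastforce
qed

text \<open>Otherwise the levels are equal. A low path between parents \<open>u'\<close> and
  \<open>v'\<close> extends to \<open>v\<close> and avoids \<open>u\<close>, although
  \<open>u\<close> is adjacent to both of its ends \<open>u'\<close> and \<open>v\<close>.\<close>

lemma level_adjacent:
  assumes "(u, v) \<in> E"
  shows "level v = Suc (level u) \<or> level u = Suc (level v)"
proof (rule ccontr)
  assume "\<not> ?thesis"
  then have eq: "level u = level v"
    using level_le_Suc[of u v] level_le_Suc[of v u] assms E_sym by (meson le_SucE le_antisym)
  have uv: "u \<noteq> v" "u \<in> V" "v \<in> V"
    using assms pair_no_loops E_in_V by fastforce+
  then have nr: "u \<noteq> r" "v \<noteq> r"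
    using eq level_eq_0_iff level_root by metis+
  obtain u' where u': "(u', u) \<in> E" "level u = Suc (level u')"
    using ex_parent uv nr by blast
  obtain v' where v': "(v', v) \<in> E" "level v = Suc (level v')"
    using ex_parent uv nr by blast
  obtain p where p: "apath u' p v'" "\<forall>x \<in> set (pawalk_verts u' p). level x \<le> level u'"
    using apath_same_level[of u' v' "level u'"] u' v' eq E_in_V by auto
  have aw: "awalk u' p v'" "distinct (pawalk_verts u' p)"
    using p(1) unfolding apath_def by simp_all
  note snoc = awalk_snoc[OF aw(1) v'(1)]
  have "v \<notin> set (pawalk_verts u' p)" "u \<notin> set (pawalk_verts u' p)"
    using p(2) eq u'(2) by auto
  then have "apath u' (p @ [(v', v)]) v" "u \<notin> set (pawalk_verts u' (p @ [(v', v)]))"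
    unfolding apath_def snoc(2) using snoc(1) aw(2) uv(1) by simp_all
  moreover have "u' \<noteq> v"
    using eq u'(2) by auto
  ultimately show False
    using no_detour u'(1) assms arcs_symmetric by blast
qed

section \<open>Parents, ancestors and descendants\<close>

definition parent :: "'a \<Rightarrow> 'a" where
  "parent v = (if v = r then r else SOME u. (u, v) \<in> E \<and> level v = Suc (level u))"

lemma parent_root [simp]: "parent r = r"
  by (simp add: parent_def)

lemma parent_adjacent:
  assumes "v \<in> V" "v \<noteq> r"
  shows "(parent v, v) \<in> E" "level v = Suc (level (parent v))"
  using someI_ex[OF ex_parent[OF assms]] assms(2) by (auto simp: parent_def)

lemma parent_eqI:
  assumes "(u, v) \<in> E" "level v = Suc (level u)"
  shows "parent v = u"
proof -
  have "v \<in> V" "v \<noteq> r"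
    using assms E_in_V level_root by auto
  then show ?thesis
    using parent_adjacent parent_unique assms by blast
qed

lemma adjacent_parent: "(u, v) \<in> E \<Longrightarrow> parent v = u \<or> parent u = v"
  using level_adjacent parent_eqI E_sym by blast

lemma parent_in_V: "v \<in> V \<Longrightarrow> parent v \<in> V"
  using parent_adjacent(1) E_in_V(1) root by (cases "v = r") auto

lemma ancestor_in_V: "v \<in> V \<Longrightarrow> (parent ^^ k) v \<in> V"
  by (induction k) (auto intro: parent_in_V)

text \<open>At the root, truncated subtraction agrees with the convention
  \<open>parent r = r\<close>, so iterating \<open>parent\<close> needs no bound on the number of
  steps.\<close>

lemma level_parent: "v \<in> V \<Longrightarrow> level (parent v) = level v - 1"
  using parent_adjacent(2)[of v] level_root by (cases "v = r") auto

lemma level_ancestor: "v \<in> V \<Longrightarrow> level ((parent ^^ k) v) = level v - k"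
  by (induction k) (auto simp: level_parent ancestor_in_V)

text \<open>The subtree hanging at \<open>w\<close>; \<open>k = 0\<close> makes a vertex its own
  descendant.\<close>

definition descendants :: "'a \<Rightarrow> 'a set" where
  "descendants w = {v \<in> V. \<exists>k. (parent ^^ k) v = w}"

section \<open>Local finiteness\<close>

lemma finite_level:
  assumes "locally_finite T"
  shows "finite {v \<in> V. level v = n}"
proof (induction n)
  case 0
  have "{v \<in> V. level v = 0} \<subseteq> {r}"
    using level_eq_0_iff by auto
  then show ?case
    using finite_subset by blast
next
  case (Suc n)
  \<comment> \<open>Each vertex of level \<open>Suc n\<close> is the head of an arc that leaves its
    parent on level \<open>n\<close>.\<close>
  have "{v \<in> V. level v = Suc n} \<subseteq> (\<Union>u \<in> {v \<in> V. level v = n}. snd ` out_arcs (with_proj T) u)"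
  proof
    fix v assume v: "v \<in> {v \<in> V. level v = Suc n}"
    then have "v \<noteq> r"
      using level_root by auto
    then have "(parent v, v) \<in> E" "level (parent v) = n"
      using parent_adjacent[of v] v by auto
    then show "v \<in> (\<Union>u \<in> {v \<in> V. level v = n}. snd ` out_arcs (with_proj T) u)"
      using E_in_V by (force simp: out_arcs_def)
  qed
  then show ?case
    using Suc assms by (auto simp: locally_finite_def intro: finite_subset)
qed

lemma countable_V:
  assumes "locally_finite T"
  shows "countable V"
proof -
  have "countable (\<Union>n. {v \<in> V. level v = n})"
    using finite_level[OF assms] by (simp add: countable_finite)
  also have "(\<Union>n. {v \<in> V. level v = n}) = V"
    by blast
  finally show ?thesis .
qed

text \<open>If level \<open>m\<close> contained no descendant, then all descendants would lie on the
  finitely many finite levels below \<open>m\<close>: the way up from a higher one to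
  \<open>w\<close> passes through level \<open>m\<close>.\<close>

lemma descendant_at_level:
  assumes "locally_finite T" "infinite (descendants w)" "level w \<le> m"
  shows "\<exists>v \<in> descendants w. level v = m"
proof (rule ccontr)
  assume no: "\<not> ?thesis"
  have "descendants w \<subseteq> (\<Union>n \<in> {..<m}. {v \<in> V. level v = n})"
  proof
    fix v assume v: "v \<in> descendants w"
    then obtain k where k: "v \<in> V" "(parent ^^ k) v = w"
      by (auto simp: descendants_def)
    have "level v < m"
    proof (rule ccontr)
      assume "\<not> level v < m"
      then have m: "m \<le> level v"
        by simp
      \<comment> \<open>The number of steps from \<open>v\<close> up to level \<open>m\<close>. If
        \<open>w\<close> were reached sooner, it would lie above level \<open>m\<close>.\<close>
      let ?j = "level v - m"
      have lw: "level w = level v - k"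
        using level_ancestor[OF k(1), of k] k(2) by simp
      show False
      proof (cases "k < ?j")
        case True
        then have "level w > m"
          using lw by auto
        then show False
          using assms(3) by simp
      next
        case False
        then have "(parent ^^ (k - ?j)) ((parent ^^ ?j) v) = w"
          using k(2) by (metis add_diff_inverse_nat add.commute comp_apply funpow_add)
        then have "(parent ^^ ?j) v \<in> descendants w"
          using ancestor_in_V[OF k(1)] unfolding descendants_def by blast
        then show False
          using no level_ancestor[OF k(1), of ?j] m by auto
      qed
    qed
    then show "v \<in> (\<Union>n \<in> {..<m}. {v \<in> V. level v = n})"
      using k by auto
  qed
  then show False
    using finite_level[OF assms(1)] assms(2) by (meson finite_UN finite_lessThan finite_subset)
qed

section \<open>Automorphisms that fix the root\<close>

context
  fixes f
  assumes auto: "automorphism T f" and fix_root: "f r = r"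
begin

lemma f_in_V: "v \<in> V \<Longrightarrow> f v \<in> V"
  using auto by (auto simp: automorphism_def bij_betw_def)

lemma f_inj: "u \<in> V \<Longrightarrow> v \<in> V \<Longrightarrow> f u = f v \<longleftrightarrow> u = v"
  using auto by (auto simp: automorphism_def bij_betw_def inj_on_def)

lemma f_surj: "v \<in> V \<Longrightarrow> \<exists>u \<in> V. f u = v"
  using auto by (metis automorphism_def bij_betw_def imageE)

lemma f_edge: "(u, v) \<in> E \<Longrightarrow> (f u, f v) \<in> E"
  using auto E_in_V unfolding automorphism_def by blast

text \<open>Induction from the root. The level could only go wrong if \<open>f v\<close> were the
  parent of \<open>f (parent v)\<close>; but that parent is the image of the grandparent of
  \<open>v\<close>, so injectivity would make \<open>v\<close> its own grandparent.\<close>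

lemma f_level:
  assumes "v \<in> V"
  shows "level (f v) = level v"
  using assms
proof (induction "level v" arbitrary: v rule: less_induct)
  case less
  show ?case
  proof (cases "v = r")
    case True
    then show ?thesis
      by (simp add: fix_root)
  next
    case False
    note p = parent_adjacent[OF less.prems False]
    have IH: "level (f (parent v)) = level (parent v)"
      using less parent_in_V p by simp
    have adj: "(f (parent v), f v) \<in> E"
      using f_edge p by blast
    show ?thesis
    proof (cases "level (f v) = Suc (level (f (parent v)))")
      case True
      then show ?thesis
        using IH p by simp
    next
      case F: False
      then have dn: "level (parent v) = Suc (level (f v))"
        using level_adjacent[OF adj] IH by simp
      then have pr: "parent v \<noteq> r"
        using level_root by auto
      let ?q = "parent (parent v)"
      note q = parent_adjacent[OF parent_in_V[OF less.prems] pr]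
      have "level (f ?q) = level ?q"
        using less(1)[of ?q] q p parent_in_V less.prems by simp
      then have "parent (f (parent v)) = f ?q"
        using f_edge[OF q(1)] IH q(2) by (intro parent_eqI) auto
      moreover have "parent (f (parent v)) = f v"
        using adj IH dn E_sym by (intro parent_eqI) auto
      ultimately have "?q = v"
        using f_inj less.prems parent_in_V by metis
      then show ?thesis
        using p q by auto
    qed
  qed
qed

lemma f_parent: "v \<in> V \<Longrightarrow> parent (f v) = f (parent v)"
  using parent_adjacent[of v] f_edge f_level parent_in_V fix_root
  by (cases "v = r") (auto intro!: parent_eqI)

lemma f_ancestor: "v \<in> V \<Longrightarrow> (parent ^^ k) (f v) = f ((parent ^^ k) v)"
  by (induction k) (auto simp: f_parent ancestor_in_V)

lemma f_descendants:
  assumes "w \<in> V"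
  shows "descendants (f w) = f ` descendants w"
proof (intro equalityI subsetI)
  fix v assume "v \<in> descendants (f w)"
  then obtain k where k: "v \<in> V" "(parent ^^ k) v = f w"
    by (auto simp: descendants_def)
  obtain u where u: "u \<in> V" "f u = v"
    using f_surj k by blast
  have "(parent ^^ k) u = w"
    using f_ancestor[OF u(1), of k] u k f_inj ancestor_in_V assms by metis
  then show "v \<in> f ` descendants w"
    using u by (auto simp: descendants_def)
qed (use f_ancestor f_in_V in \<open>force simp: descendants_def\<close>)

text \<open>Going up equally many steps from \<open>v\<close> and from \<open>f v\<close> leads to
  \<open>w\<close> and to \<open>f w\<close>.\<close>

lemma fixed_descendant:
  assumes "v \<in> descendants w" "f v = v"
  shows "f w = w"
  using assms f_ancestor by (force simp: descendants_def)

text \<open>A moved vertex \<open>x\<close> of least level has a fixed parent \<open>w\<close>. The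
  automorphism \<open>g\<close> acts as \<open>f\<close> on the finite branches at \<open>w\<close>
  and as the identity elsewhere.\<close>

lemma ex_automorphism_finite_moved:
  assumes lf: "locally_finite T"
    and large: "\<And>w. w \<in> V \<Longrightarrow> infinite (descendants w) \<Longrightarrow> f w = w"
    and moved: "v \<in> V" "f v \<noteq> v"
  shows "\<exists>g. automorphism T g \<and> moved_verts T g \<noteq> {} \<and> finite (moved_verts T g)"
proof -
  obtain x where x: "x \<in> V" "f x \<noteq> x"
    and x_min: "\<And>y. y \<in> V \<Longrightarrow> f y \<noteq> y \<Longrightarrow> level x \<le> level y"
    using ex_has_least_nat[of "\<lambda>y. y \<in> V \<and> f y \<noteq> y" v level] moved by blast
  have xr: "x \<noteq> r"
    using x fix_root by auto
  define w where "w = parent x"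
  have w: "w \<in> V" "f w = w"
    using x_min[of w] parent_adjacent[OF x(1) xr] parent_in_V x unfolding w_def by fastforce+
  \<comment> \<open>All children of \<open>w\<close> with finite branches are taken, because
    \<open>f\<close> may exchange the branch of \<open>x\<close> with others.\<close>
  define B where "B = {y \<in> V. (w, y) \<in> E \<and> parent y = w \<and> finite (descendants y)}"
  define K where "K = (\<Union>y \<in> B. descendants y)"
  define g where "g u = (if u \<in> K then f u else u)" for u
  have KV: "K \<subseteq> V"
    by (auto simp: K_def descendants_def)
  \<comment> \<open>Large vertices are fixed and \<open>x\<close> is moved, so its branch is
    finite.\<close>
  have "x \<in> B"
    using x xr parent_adjacent[OF x(1) xr] large by (auto simp: B_def w_def)
  then have xK: "x \<in> K"
    using x unfolding K_def descendants_def by (auto intro!: bexI[of _ x] exI[of _ 0])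
  have "B \<subseteq> snd ` out_arcs (with_proj T) w"
    by (force simp: B_def out_arcs_def)
  then have "finite B"
    using lf w by (auto simp: locally_finite_def intro: finite_subset)
  then have finK: "finite K"
    by (auto simp: K_def B_def)
  \<comment> \<open>As \<open>w\<close> is fixed, \<open>f\<close> permutes its children; it maps
    branches bijectively onto branches, hence finite ones to finite ones.\<close>
  have fB: "f y \<in> B \<longleftrightarrow> y \<in> B" if "y \<in> V" for y
  proof -
    have "(w, f y) \<in> E \<longleftrightarrow> (w, y) \<in> E"
      using auto w that by (metis automorphism_def)
    moreover have "parent (f y) = w \<longleftrightarrow> parent y = w"
      using f_parent[OF that] f_inj w that parent_in_V by metis
    moreover have "inj_on f (descendants y)"
      using f_inj by (auto simp: inj_on_def descendants_def)
    ultimately show ?thesis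
      using that f_in_V f_descendants[OF that] by (auto simp: B_def finite_image_iff)
  qed
  have K_iff: "z \<in> K \<longleftrightarrow> (\<exists>k. (parent ^^ k) z \<in> B)" if "z \<in> V" for z
    using that by (auto simp: K_def descendants_def)
  have fK: "f z \<in> K \<longleftrightarrow> z \<in> K" if "z \<in> V" for z
    using K_iff that f_in_V f_ancestor fB ancestor_in_V by auto
  \<comment> \<open>Children of vertices in \<open>K\<close> are in \<open>K\<close>; the parent of
    a vertex in \<open>K\<close> is also in \<open>K\<close>, unless the vertex is a top vertex in
    \<open>B\<close>, whose parent is \<open>w\<close>.\<close>
  have boundary: "v = w" if e: "(u, v) \<in> E" "u \<in> K" "v \<notin> K" for u v
  proof -
    have uv: "u \<in> V" "v \<in> V"
      using e(1) E_in_V by auto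
    obtain k where k: "(parent ^^ k) u \<in> B"
      using K_iff e uv by auto
    consider "parent v = u" | "parent u = v"
      using adjacent_parent e(1) by blast
    then show ?thesis
    proof cases
      case 1
      then have "(parent ^^ Suc k) v \<in> B"
        using k by (simp add: funpow_swap1)
      then show ?thesis
        using K_iff uv e by blast
    next
      case 2
      show ?thesis
      proof (cases k)
        case 0
        then show ?thesis
          using k 2 by (auto simp: B_def)
      next
        case (Suc j)
        then have "(parent ^^ j) v \<in> B"
          using k 2 by (simp add: funpow_swap1)
        then show ?thesis
          using K_iff uv e by blast
      qed
    qed
  qed
  \<comment> \<open>Such an edge must end at \<open>w\<close>, and \<open>f w = w\<close>. This
    settles the pairs on which \<open>g\<close> mixes \<open>f\<close> with the identity.\<close>
  have edge_iff: "(u, v) \<in> E \<longleftrightarrow> (f u, v) \<in> E" if "u \<in> K" "v \<in> V" "v \<notin> K" for u v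
  proof -
    have "(u, w) \<in> E \<longleftrightarrow> (f u, w) \<in> E"
      using auto w that KV by (metis automorphism_def subsetD)
    then show ?thesis
      using boundary[of u v] boundary[of "f u" v] that fK KV by blast
  qed
  have "bij_betw g V V"
  proof (rule bij_betw_imageI)
    show "inj_on g V"
      using f_inj fK unfolding inj_on_def g_def by metis
    show "g ` V = V"
    proof (intro equalityI subsetI)
      fix v assume "v \<in> V"
      then obtain u where u: "u \<in> V" "f u = v"
        using f_surj by blast
      show "v \<in> g ` V"
      proof (cases "v \<in> K")
        case True
        then show ?thesis
          using u fK by (intro image_eqI[of _ _ u]) (auto simp: g_def)
      next
        case False
        then show ?thesis
          using \<open>v \<in> V\<close> by (intro image_eqI[of _ _ v]) (auto simp: g_def)
      qed
    qed (auto simp: g_def f_in_V)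
  qed
  moreover have "(u, v) \<in> E \<longleftrightarrow> (g u, g v) \<in> E" if "u \<in> V" "v \<in> V" for u v
  proof -
    have "(u, v) \<in> E \<longleftrightarrow> (f u, f v) \<in> E"
      using auto that by (auto simp: automorphism_def)
    then show ?thesis
      using edge_iff[of u v] edge_iff[of v u] E_sym that unfolding g_def by metis
  qed
  ultimately have "automorphism T g"
    by (simp add: automorphism_def)
  moreover have "moved_verts T g \<subseteq> K" "x \<in> moved_verts T g"
    using x xK by (auto simp: moved_verts_def g_def)
  ultimately show ?thesis
    using finK finite_subset by blast
qed

end

section \<open>The colouring\<close>

lemma ex_distinguishing_colouring:
  assumes lf: "locally_finite T" and inf: "infinite V" and motion: "motion T = \<infinity>"
  shows "\<exists>c :: 'a \<Rightarrow> nat. proper_colouring T c \<and> distinguishing_colouring T c \<and> c ` V \<subseteq> {0, 1, 2}"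
proof -
  define L where "L = {w \<in> V. infinite (descendants w)}"
  \<comment> \<open>The pairing is injective on vertices and at least \<open>level w\<close>, so
    \<open>descendant_at_level\<close> applies. Doubling and adding 3 makes the value odd and at
    least 3.\<close>
  define h where "h w = 2 * prod_encode (to_nat_on V w, level w) + 3" for w
  have h_inj: "w = w'" if "w \<in> L" "w' \<in> L" "h w = h w'" for w w'
    using that countable_V[OF lf] by (auto simp: h_def L_def)
  have "\<exists>v \<in> descendants w. level v = h w" if "w \<in> L" for w
    using that le_prod_encode_2[of "level w" "to_nat_on V w"]
    by (intro descendant_at_level[OF lf]) (auto simp: L_def h_def)
  then obtain d where d: "\<And>w. w \<in> L \<Longrightarrow> d w \<in> descendants w" "\<And>w. w \<in> L \<Longrightarrow> level (d w) = h w"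
    by metis
  define S where "S = d ` L"
  have S: "s \<in> V" "odd (level s)" "level s \<ge> 3" if "s \<in> S" for s
    using that d by (auto simp: S_def descendants_def h_def)
  \<comment> \<open>\<open>S\<close> has at most one vertex on each level, so a level-preserving map
    of \<open>S\<close> into itself fixes it pointwise.\<close>
  have S_inj: "s = t" if st: "s \<in> S" "t \<in> S" "level s = level t" for s t
  proof -
    obtain w w' where w: "w \<in> L" "w' \<in> L" "s = d w" "t = d w'"
      using st(1,2) unfolding S_def by blast
    then have "h w = h w'"
      using d(2) st(3) by simp
    then show ?thesis
      using h_inj w by blast
  qed
  have r_notin_S: "r \<notin> S"
    using S level_root by fastforce
  define c :: "'a \<Rightarrow> nat" where "c v = (if v = r \<or> v \<in> S then 2 else level v mod 2)" for v
  have c2: "c v = 2 \<longleftrightarrow> v = r \<or> v \<in> S" for v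
    by (auto simp: c_def)
  \<comment> \<open>Level 1 is too low to meet \<open>S\<close>, so parity decides the
    colour.\<close>
  have nbr_r: "c v = 1" if "(r, v) \<in> E" for v
  proof -
    have "level v = 1"
      using level_adjacent[OF that] level_root by simp
    then show ?thesis
      using S level_root by (fastforce simp: c_def)
  qed
  \<comment> \<open>The level of \<open>v\<close> is even, hence \<open>v\<close> is not in
    \<open>S\<close>, and it is at least 2, hence \<open>v\<close> is not the root.\<close>
  have nbr_S: "c v = 0" if "(s, v) \<in> E" "s \<in> S" for s v
  proof -
    have "even (level v)" "v \<noteq> r"
      using level_adjacent[OF that(1)] S[OF that(2)] level_root by auto
    then show ?thesis
      using S by (auto simp: c_def)
  qed
  have "c u \<noteq> c v" if uv: "(u, v) \<in> E" for u v
  proof (cases "c u = 2 \<or> c v = 2")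
    case True
    then show ?thesis
      using nbr_r nbr_S c2 uv E_sym by (metis zero_neq_numeral one_eq_numeral_iff num.distinct(1))
  next
    case False
    then have "c u = level u mod 2" "c v = level v mod 2"
      by (auto simp: c_def split: if_splits)
    moreover have "even (level u) \<longleftrightarrow> odd (level v)"
      using level_adjacent[OF uv] by (elim disjE) simp_all
    ultimately show ?thesis
      by (metis even_iff_mod_2_eq_zero)
  qed
  then have proper: "proper_colouring T c"
    by (simp add: proper_colouring_def)
  have "f v = v" if f: "automorphism T f" "preserves_colouring T f c" and v: "v \<in> V" for f v
  proof (rule ccontr)
    assume moved: "f v \<noteq> v"
    have cf: "c (f u) = c u" if "u \<in> V" for u
      using f(2) that by (auto simp: preserves_colouring_def)
    \<comment> \<open>There is a vertex besides \<open>r\<close>; its ancestor on level 1 is a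
      neighbour \<open>x\<close> of \<open>r\<close>, on which the argument for
      \<open>f r = r\<close> relies.\<close>
    have "infinite (V - {r})"
      using inf by simp
    then obtain u where "u \<in> V" "u \<noteq> r"
      using infinite_imp_nonempty by blast
    obtain x where x: "(r, x) \<in> E"
    proof -
      have "level u > 0"
        using level_eq_0_iff \<open>u \<in> V\<close> \<open>u \<noteq> r\<close> by blast
      then have l: "level ((parent ^^ (level u - 1)) u) = 1"
        using level_ancestor[OF \<open>u \<in> V\<close>] by simp
      let ?y = "(parent ^^ (level u - 1)) u"
      have y: "?y \<in> V" "?y \<noteq> r"
        using ancestor_in_V \<open>u \<in> V\<close> l level_root by auto
      have "level (parent ?y) = 0"
        using level_parent[OF y(1)] l by simp
      then have "parent ?y = r"
        using level_eq_0_iff parent_in_V y by blast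
      then show thesis
        using that parent_adjacent[OF y] by metis
    qed
    \<comment> \<open>By its colour, \<open>f r\<close> is \<open>r\<close> or in \<open>S\<close>.
      In the latter case the neighbour \<open>f x\<close> of \<open>f r\<close> has colour 0,
      whereas \<open>x\<close> has colour 1.\<close>
    have fr: "f r = r"
    proof (rule ccontr)
      assume "f r \<noteq> r"
      then have "f r \<in> S"
        using cf[OF root] c2[of r] c2[of "f r"] by simp
      moreover have "(f r, f x) \<in> E"
        using f(1) x E_in_V unfolding automorphism_def by blast
      ultimately have "c (f x) = 0"
        using nbr_S by blast
      then show False
        using nbr_r[OF x] cf[OF E_in_V(2)[OF x]] by simp
    qed
    \<comment> \<open>The image has colour 2 and is not \<open>r\<close>, so it is the vertex of
      \<open>S\<close> on the level of \<open>s\<close>.\<close>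
    have "f s = s" if "s \<in> S" for s
    proof -
      have "f s \<noteq> r"
        using f_inj[OF f(1) fr S(1)[OF that] root] fr r_notin_S that by metis
      then have "f s \<in> S"
        using cf[OF S(1)[OF that]] c2[of s] c2[of "f s"] that by simp
      then show ?thesis
        using S_inj that f_level[OF f(1) fr S(1)[OF that]] by blast
    qed
    then have "f w = w" if "w \<in> V" "infinite (descendants w)" for w
      using fixed_descendant[OF f(1) fr d(1)] that by (auto simp: S_def L_def)
    then obtain g where "automorphism T g" "moved_verts T g \<noteq> {}" "finite (moved_verts T g)"
      using ex_automorphism_finite_moved[OF f(1) fr lf _ v moved] by blast
    then show False
      using motion unfolding motion_eq_infinity_iff moved_verts_def by blast
  qed
  then have "distinguishing_colouring T c"
    by (auto simp: distinguishing_colouring_def)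
  moreover have "c ` V \<subseteq> {0, 1, 2}"
    by (auto simp: c_def)
  ultimately show ?thesis
    using proper by blast
qed

end

section \<open>The bound on the distinguishing chromatic number\<close>

theorem theorem9:
  fixes T :: "'a pair_pre_digraph"
  assumes "undirected_tree T"
    and "infinite (pverts T)"
    and "locally_finite T"
    and "motion T = \<infinity>"
  shows "distinguishing_chromatic_number T \<le> 3"
proof -
  \<comment> \<open>Any vertex can serve as the root.\<close>
  obtain r where r: "r \<in> pverts T"
    using assms(2) by fastforce
  interpret pair_bidirected_digraph T
    using assms(1) by (simp add: undirected_tree_def)
  interpret rooted_tree T r
    using assms(1) r by unfold_locales (auto simp: undirected_tree_def not_le[symmetric])
  obtain c :: "'a \<Rightarrow> nat" where c: "proper_colouring T c" "distinguishing_colouring T c"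
    "c ` pverts T \<subseteq> {0, 1, 2}"
    using ex_distinguishing_colouring assms by blast
  \<comment> \<open>The colouring \<open>c\<close> is one of those over which the infimum is
    taken.\<close>
  have "distinguishing_chromatic_number T \<le> ecard (c ` pverts T)"
    unfolding distinguishing_chromatic_number_def using c by (intro INF_lower) simp
  also have "\<dots> \<le> 3"
  proof -
    have "finite (c ` pverts T)"
      using c(3) finite_subset by blast
    moreover have "card (c ` pverts T) \<le> card {0 :: nat, 1, 2}"
      using c(3) by (intro card_mono) auto
    ultimately show ?thesis
      by (simp add: ecard_def numeral_eq_enat)
  qed
  finally show ?thesis .
qed

end
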